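(* Let $(\widehat\theta_{k_c})_{k_c\ge\pi}$ be a fixed family of admissible cut-off functions (as defined in the context), let $\lambda\in\mathbb{C}$ and let $K_V,K_G>0$. Then there exist constants $C_{V,g,m}$ ($m=0,1,2,\dots$), depending only on $m$, $\lambda$, $K_V$, $K_G$ and the constants $C_{\theta,j}$ of the family, and in particular independent of $L$ and $k_c$, such that the following holds. Let $L\ge1$, let $N\ge32$ be an even integer with $\Delta x=L/N\le1$, set $k_c=\pi/\Delta x$, and let $V:\mathcal{X}\to\mathbb{R}$ with $\|V\|_{L^\infty(\mathcal{X})}\le K_V$. Define the matrix $$\widehat H_{kl}=\widehat h_k\delta_{kl}+\frac1L\widehat V_{k-l},\qquad k,l\in\mathcal{K},$$ and assume that $\lambda-\widehat H$ is invertible and that the discretized Green's function $\widehat G=(\lambda-\widehat H)^{-1}$ satisfies $\|\widehat G\|_{\mathcal{L}(L^2(\mathcal{K}))}\le K_G$. Let $g\in L^2(\mathcal{X})$ be the inverse discrete Fourier transform of $\widehat g$ defined by $$\lambda\widehat g_k-\sum_{l\in\mathcal{K}}\widehat H_{kl}\widehat g_l=1,\qquad k\in\mathcal{K}.$$ Then for all integers $0\le m\le M=\frac N{16}$, $$\|d(\cdot,0)^m g\|_2\le C_{V,g,m}.$$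
   Context: Grids: for $L>0$ and an even positive integer $N$, $\Delta x=L/N$, $\mathcal{X}=\{i\Delta x:i=0,\dots,N-1\}$, $\Delta k=2\pi/L$, $\mathcal{K}=\{n\Delta k: n=-\frac N2+1,\dots,\frac N2\}$, $k_c=\frac N2\Delta k=\pi/\Delta x$ (so $k_c\ge\pi$ when $\Delta x\le1$). Norms: $\|f\|_2^2=\|f\|_{L^2(\mathcal X)}^2=\Delta x\sum_{x\in\mathcal{X}}|f(x)|^2$, $\|f\|_{L^\infty(\mathcal X)}=\max_{x\in\mathcal X}|f(x)|$, $\|\widehat f\|_{L^2(\mathcal{K})}^2=\Delta k\sum_{k\in\mathcal{K}}|\widehat f_k|^2$; $\|\cdot\|_{\mathcal{L}(L^2(\mathcal{K}))}$ is the induced operator norm (the matrix 2-norm). Discrete Fourier transform: $\widehat f_k=\Delta x\sum_{x\in\mathcal{X}}e^{-\mathrm{i}kx}f(x)$, with inverse $f(x)=\frac1L\sum_{k\in\mathcal{K}}e^{\mathrm{i}kx}\widehat f_k$. Fourier indices are interpreted periodically with period $N\Delta k$ (so $\widehat V_{k-l}$ is given by the same formula for any difference $k-l$). $\delta_{kl}$ is the Kronecker symbol. Distance: $d(x,0)=x$ for $x\in[0,L/2)$ and $d(x,0)=L-x$ for $x\in[L/2,L)$. Admissible family of cut-offs: for each $k_c\ge\pi$ a function $\widehat\theta=\widehat\theta_{k_c}\in C^\infty(\mathbb{R})$ with $0\le\widehat\theta\le1$, $\widehat\theta(k)=1$ for $|k|\le\frac12k_c$, $\widehat\theta(k)=0$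 for $|k|\ge\frac34k_c$, such that for each integer $m\ge0$ there is a constant $C_{\theta,m}$ independent of $k_c$ with $\sup_{k\in\mathbb{R}}\bigl|\frac{\mathrm d^m\widehat\theta}{\mathrm dk^m}(k)\bigr|\le C_{\theta,m}$. Mollified Laplacian symbol: $\widehat h(k)=\widehat\theta(k)(k^2-k_c^2)+k_c^2$ and $\widehat h_k=\widehat h(k)$ for $k\in\mathcal{K}$. *)

theory Defs
  imports "HOL-Analysis.Analysis"
begin

text \<open>The grids are sets of real numbers, and grid functions are functions on the reals of which
  only the values on the grid matter.\<close>

definition dx :: "real \<Rightarrow> nat \<Rightarrow> real" where
  "dx L N = L / real N"

definition dk :: "real \<Rightarrow> real" where
  "dk L = 2 * pi / L"

definition kcut :: "real \<Rightarrow> nat \<Rightarrow> real" where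
  "kcut L N = pi / dx L N"

definition Xgrid :: "real \<Rightarrow> nat \<Rightarrow> real set" where
  "Xgrid L N = (\<lambda>i. real i * dx L N) ` {0..<N}"

definition Kgrid :: "real \<Rightarrow> nat \<Rightarrow> real set" where
  "Kgrid L N = (\<lambda>n. real_of_int n * dk L) ` {- (int N div 2) + 1 .. int N div 2}"

definition l2_norm_X :: "real \<Rightarrow> nat \<Rightarrow> (real \<Rightarrow> complex) \<Rightarrow> real" where
  "l2_norm_X L N f = sqrt (dx L N * (\<Sum>x\<in>Xgrid L N. (cmod (f x))\<^sup>2))"

definition linf_norm_X :: "real \<Rightarrow> nat \<Rightarrow> (real \<Rightarrow> complex) \<Rightarrow> real" where
  "linf_norm_X L N f = Max ((\<lambda>x. cmod (f x)) ` Xgrid L N)"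

definition l2_norm_K :: "real \<Rightarrow> nat \<Rightarrow> (real \<Rightarrow> complex) \<Rightarrow> real" where
  "l2_norm_K L N f = sqrt (dk L * (\<Sum>k\<in>Kgrid L N. (cmod (f k))\<^sup>2))"

text \<open>Matrices indexed by \<open>K \<times> K\<close> are functions of two arguments of which only the values on
  \<open>K \<times> K\<close> matter.\<close>

definition mat_app :: "real set \<Rightarrow> (real \<Rightarrow> real \<Rightarrow> complex) \<Rightarrow> (real \<Rightarrow> complex) \<Rightarrow> real \<Rightarrow> complex" where
  "mat_app K A f = (\<lambda>k. \<Sum>l\<in>K. A k l * f l)"

definition kron :: "real \<Rightarrow> real \<Rightarrow> complex" where
  "kron k l = (if k = l then 1 else 0)"

definition is_mat_inverse ::
    "real set \<Rightarrow> (real \<Rightarrow> real \<Rightarrow> complex) \<Rightarrow> (real \<Rightarrow> real \<Rightarrow> complex) \<Rightarrow> bool" where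
  "is_mat_inverse K A B \<longleftrightarrow>
     (\<forall>k\<in>K. \<forall>l\<in>K. (\<Sum>j\<in>K. A k j * B j l) = kron k l \<and> (\<Sum>j\<in>K. B k j * A j l) = kron k l)"

text \<open>The induced operator norm, in the form of \<^const>\<open>onorm\<close>: for \<open>f\<close> vanishing on the grid the
  quotient is \<open>0\<close>, and the supremum is over a bounded set since the grid is finite.\<close>

definition op_norm_K :: "real \<Rightarrow> nat \<Rightarrow> (real \<Rightarrow> real \<Rightarrow> complex) \<Rightarrow> real" where
  "op_norm_K L N A = (SUP f. l2_norm_K L N (mat_app (Kgrid L N) A f) / l2_norm_K L N f)"

text \<open>The transform is defined at every real \<open>k\<close>; on integer multiples of \<^term>\<open>dk L\<close> it is
  periodic with period \<^term>\<open>real N * dk L\<close>.\<close>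

definition dft :: "real \<Rightarrow> nat \<Rightarrow> (real \<Rightarrow> complex) \<Rightarrow> real \<Rightarrow> complex" where
  "dft L N f k = of_real (dx L N) * (\<Sum>x\<in>Xgrid L N. exp (- \<i> * of_real (k * x)) * f x)"

definition idft :: "real \<Rightarrow> nat \<Rightarrow> (real \<Rightarrow> complex) \<Rightarrow> real \<Rightarrow> complex" where
  "idft L N fh x = of_real (1 / L) * (\<Sum>k\<in>Kgrid L N. exp (\<i> * of_real (k * x)) * fh k)"

text \<open>The distance of \<open>x \<in> [0, L)\<close> to \<open>0\<close> on the circle of length \<open>L\<close>.\<close>

definition dist0 :: "real \<Rightarrow> real \<Rightarrow> real" where
  "dist0 L x = (if x < L / 2 then x else L - x)"

definition smooth_real :: "(real \<Rightarrow> real) \<Rightarrow> bool" where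
  "smooth_real f \<longleftrightarrow> (\<forall>m. (deriv ^^ m) f differentiable_on UNIV)"

text \<open>The family is indexed by the cut-off frequency \<open>kc\<close>; the constants \<open>Cth m\<close> bounding the
  derivatives do not depend on \<open>kc\<close>.\<close>

definition admissible_cutoffs :: "(nat \<Rightarrow> real) \<Rightarrow> (real \<Rightarrow> real \<Rightarrow> real) \<Rightarrow> bool" where
  "admissible_cutoffs Cth \<theta> \<longleftrightarrow>
     (\<forall>kc\<ge>pi.
        smooth_real (\<theta> kc) \<and>
        (\<forall>k. 0 \<le> \<theta> kc k \<and> \<theta> kc k \<le> 1) \<and>
        (\<forall>k. \<bar>k\<bar> \<le> kc / 2 \<longrightarrow> \<theta> kc k = 1) \<and>
        (\<forall>k. \<bar>k\<bar> \<ge> 3 / 4 * kc \<longrightarrow> \<theta> kc k = 0) \<and>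
        (\<forall>m k. \<bar>(deriv ^^ m) (\<theta> kc) k\<bar> \<le> Cth m))"

definition hsym :: "(real \<Rightarrow> real \<Rightarrow> real) \<Rightarrow> real \<Rightarrow> real \<Rightarrow> real" where
  "hsym \<theta> kc k = \<theta> kc k * (k\<^sup>2 - kc\<^sup>2) + kc\<^sup>2"

definition Hmat ::
    "(real \<Rightarrow> real \<Rightarrow> real) \<Rightarrow> real \<Rightarrow> nat \<Rightarrow> (real \<Rightarrow> real) \<Rightarrow> real \<Rightarrow> real \<Rightarrow> complex" where
  "Hmat \<theta> L N V k l =
     of_real (hsym \<theta> (kcut L N) k) * kron k l
     + of_real (1 / L) * dft L N (\<lambda>x. of_real (V x)) (k - l)"

end

theory Submission
  imports Defs
begin

text \<open>
  Multiplication by \<open>p x = (exp (\<i> \<Delta>k x) - 1) / \<Delta>k\<close>, whose modulus is at least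
  \<open>2 / \<pi>\<close> times the distance, commutes with \<open>V\<close> and acts on the Fourier side as the backward
  difference of step \<open>\<Delta>k\<close>. Since it kills the discrete delta, the discrete Leibniz rule gives
  \<open>(\<lambda> - H) p\<^sup>m g = (\<Sum>j=1..m. (m choose j) D\<^sup>j h \<cdot> S\<^sup>j p\<^sup>m\<^sup>-\<^sup>j g)\<close>, with \<open>S\<close> the shift by
  \<open>\<Delta>k\<close>. The cut-off derivatives are only bounded, so \<open>D\<^sup>j h\<close> can be of size \<open>kc\<^sup>2\<close>, but never
  larger than a constant times \<open>1 + h\<close>; this is exactly the loss that the Green's function recovers,
  as \<open>G (1 + h)\<close> is bounded on \<open>L\<^sup>2\<close> independently of the grid. Induction on \<open>m\<close> concludes, the case \<open>m = 0\<close> being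
  the same bound applied to the delta, for which \<open>1 / (1 + h)\<close> is square summable. The condition
  \<open>m \<le> N / 16\<close> keeps the difference stencils away from the region where the periodic extension
  of \<open>h\<close> differs from \<open>h\<close>.
\<close>

subsection \<open>The discrete Fourier transform\<close>

text \<open>A geometric sum whose ratio is an \<open>N\<close>-th root of unity, equal to 1 exactly
  when \<open>N\<close> divides \<open>c\<close>. This is the orthogonality of characters behind
  Fourier inversion and Parseval.\<close>

lemma sum_exp_roots_of_unity:
  fixes c :: int
  assumes "N > 0"
  shows "(\<Sum>j<N. exp (\<i> * of_real (2 * pi * of_int c * real j / real N))) = (if int N dvd c then of_nat N else 0)"
proof -
  define z where "z = exp (\<i> * of_real (2 * pi * of_int c / real N))"
  have zj: "exp (\<i> * of_real (2 * pi * of_int c * real j / real N)) = z ^ j" for j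
    unfolding z_def exp_of_nat_mult[symmetric] by (simp add: field_simps)
  have zN: "z ^ N = 1"
  proof -
    have "z ^ N = exp (\<i> * of_real (2 * pi * of_int c))"
      using zj[of N] assms by simp
    also have "\<dots> = 1" by (subst exp_eq_1) (auto intro!: exI[of _ c])
    finally show ?thesis .
  qed
  have z1: "z = 1 \<longleftrightarrow> int N dvd c"
  proof
    assume "z = 1"
    then obtain n :: int where "2 * pi * of_int c / real N = of_int (2 * n) * pi"
      unfolding z_def exp_eq_1 by auto
    then have "real_of_int c = of_int (n * int N)"
      using assms by (simp add: field_simps)
    then show "int N dvd c" by (metis dvd_triv_right of_int_eq_iff)
  next
    assume "int N dvd c"
    then obtain n where n: "c = int N * n" by blast
    have "2 * pi * of_int c / real N = of_int (2 * n) * pi"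
      using assms by (simp add: n)
    then show "z = 1" unfolding z_def exp_eq_1 by auto
  qed
  show ?thesis
  proof (cases "z = 1")
    case True
    then show ?thesis using z1 unfolding zj by simp
  next
    case False
    then show ?thesis using z1 zN unfolding zj by (simp add: geometric_sum)
  qed
qed

lemma l2_norm_K_eq_L2_set:
  "l2_norm_K L N f = sqrt (dk L) * L2_set (\<lambda>k. cmod (f k)) (Kgrid L N)"
  unfolding l2_norm_K_def L2_set_def by (simp add: real_sqrt_mult)

lemma finite_Kgrid [simp]: "finite (Kgrid L N)"
  unfolding Kgrid_def by simp

locale fourier_grid =
  fixes L :: real and N :: nat
  assumes L_pos: "L > 0" and N_pos: "N > 0" and even_N: "even N"
begin

lemma dx_pos: "dx L N > 0"
  using L_pos N_pos by (simp add: dx_def)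

lemma dk_pos: "dk L > 0"
  using L_pos by (simp add: dk_def)

lemma kcut_eq: "kcut L N = real N / 2 * dk L"
  using L_pos by (simp add: kcut_def dx_def dk_def)

lemma dk_dx: "of_int n * dk L * (real j * dx L N) = 2 * pi * of_int n * real j / real N"
  using L_pos by (simp add: dk_def dx_def)

abbreviation modes :: "int set" where
  "modes \<equiv> {- (int N div 2) + 1 .. int N div 2}"

lemma sum_Xgrid: "(\<Sum>x\<in>Xgrid L N. f x) = (\<Sum>j<N. f (real j * dx L N))"
proof -
  have "inj_on (\<lambda>i. real i * dx L N) {0..<N}"
    using dx_pos by (auto simp: inj_on_def)
  then show ?thesis
    unfolding Xgrid_def by (simp add: sum.reindex lessThan_atLeast0)
qed

lemma sum_Kgrid: "(\<Sum>k\<in>Kgrid L N. f k) = (\<Sum>n\<in>modes. f (of_int n * dk L))"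
proof -
  have "inj_on (\<lambda>n. real_of_int n * dk L) modes"
    using dk_pos by (auto simp: inj_on_def)
  then show ?thesis
    unfolding Kgrid_def by (simp add: sum.reindex)
qed

lemma dft_grid:
  "dft L N f k = of_real (dx L N) * (\<Sum>j<N. exp (- \<i> * of_real (k * (real j * dx L N))) * f (real j * dx L N))"
  unfolding dft_def sum_Xgrid ..

lemma sum_modes_exp:
  fixes c :: int
  shows "(\<Sum>n\<in>modes. exp (\<i> * of_real (2 * pi * of_int n * of_int c / real N))) = (if int N dvd c then of_nat N else 0)"
proof -
  \<comment> \<open>The smallest mode; as \<open>N\<close> is even, the modes are the
    \<open>N\<close> consecutive integers starting there.\<close>
  define s where "s = - (int N div 2) + 1"
  have modes: "modes = (\<lambda>j. int j + s) ` {..<N}"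
  proof (intro equalityI subsetI)
    fix n assume "n \<in> modes"
    moreover have "int N = 2 * (int N div 2)" using even_N by presburger
    ultimately show "n \<in> (\<lambda>j. int j + s) ` {..<N}"
      by (intro image_eqI[of _ _ "nat (n - s)"]) (auto simp: s_def)
  next
    fix n assume "n \<in> (\<lambda>j. int j + s) ` {..<N}"
    moreover have "int N = 2 * (int N div 2)" using even_N by presburger
    ultimately show "n \<in> modes" by (auto simp: s_def)
  qed
  have "(\<Sum>n\<in>modes. exp (\<i> * of_real (2 * pi * of_int n * of_int c / real N)))
      = (\<Sum>j<N. exp (\<i> * of_real (2 * pi * of_int (int j + s) * of_int c / real N)))"
    unfolding modes by (subst sum.reindex) (auto simp: inj_on_def)
  also have "\<dots> = (\<Sum>j<N. exp (\<i> * of_real (2 * pi * of_int s * of_int c / real N))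
      * exp (\<i> * of_real (2 * pi * of_int c * real j / real N)))"
    by (intro sum.cong refl, unfold exp_add[symmetric])
      (simp add: algebra_simps add_divide_distrib)
  also have "\<dots> = exp (\<i> * of_real (2 * pi * of_int s * of_int c / real N)) * (if int N dvd c then of_nat N else 0)"
    by (simp only: sum_distrib_left[symmetric] sum_exp_roots_of_unity[OF N_pos])
  also have "\<dots> = (if int N dvd c then of_nat N else 0)"
  \<comment> \<open>The phase caused by the starting index matters only when the sum is nonzero, and
    then it equals 1.\<close>
  proof (cases "int N dvd c")
    case True
    then obtain n where n: "c = int N * n" by blast
    have "exp (\<i> * of_real (2 * pi * of_int s * of_int c / real N)) = 1"
      unfolding exp_eq_1 using N_pos by (auto intro!: exI[of _ "s * n"] simp: n)
    then show ?thesis using True by simp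
  qed simp
  finally show ?thesis .
qed

lemma parseval: "l2_norm_K L N (dft L N f) = sqrt (2 * pi) * l2_norm_X L N f"
proof -
  define F where "F j = f (real j * dx L N)" for j
  define E :: "int \<Rightarrow> nat \<Rightarrow> complex" where "E n j = exp (- \<i> * of_real (2 * pi * of_int n * real j / real N))" for n j
  have dvd: "int N dvd int j - int i \<longleftrightarrow> i = j" if "i < N" "j < N" for i j
  proof
    assume d: "int N dvd int j - int i"
    have "\<bar>int j - int i\<bar> < int N" using that by auto
    then show "i = j" using d zdvd_not_zless[of "\<bar>int j - int i\<bar>" "int N"] by (cases "i = j") auto
  qed simp
  have "of_real (\<Sum>n\<in>modes. (cmod (dft L N f (of_int n * dk L)))\<^sup>2)
      = (\<Sum>n\<in>modes. of_real ((dx L N)\<^sup>2) * (\<Sum>i<N. \<Sum>j<N. (E n i * F i) * cnj (E n j * F j)))"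
    unfolding of_real_sum
  proof (intro sum.cong refl)
    fix n
    have "dft L N f (of_int n * dk L) = of_real (dx L N) * (\<Sum>j<N. E n j * F j)"
      unfolding dft_grid dk_dx E_def F_def ..
    then have "(cmod (dft L N f (of_int n * dk L)))\<^sup>2 = (dx L N)\<^sup>2 * (cmod (\<Sum>j<N. E n j * F j))\<^sup>2"
      by (simp add: norm_mult power_mult_distrib)
    then show "of_real ((cmod (dft L N f (of_int n * dk L)))\<^sup>2)
        = of_real ((dx L N)\<^sup>2) * (\<Sum>i<N. \<Sum>j<N. (E n i * F i) * cnj (E n j * F j))"
      by (simp only: of_real_mult complex_norm_square cnj_sum sum_product)
  qed
  also have "\<dots> = of_real ((dx L N)\<^sup>2) * (\<Sum>i<N. \<Sum>j<N. F i * cnj (F j) * (\<Sum>n\<in>modes. E n i * cnj (E n j)))"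
  proof -
    have "(\<Sum>n\<in>modes. \<Sum>i<N. \<Sum>j<N. (E n i * F i) * cnj (E n j * F j))
        = (\<Sum>i<N. \<Sum>j<N. \<Sum>n\<in>modes. (E n i * F i) * cnj (E n j * F j))"
      by (rule trans[OF sum.swap]) (rule sum.cong[OF refl sum.swap])
    also have "\<dots> = (\<Sum>i<N. \<Sum>j<N. F i * cnj (F j) * (\<Sum>n\<in>modes. E n i * cnj (E n j)))"
      unfolding sum_distrib_left by (intro sum.cong refl) (simp add: mult_ac)
    finally show ?thesis by (simp only: sum_distrib_left[symmetric])
  qed
  also have "\<dots> = of_real ((dx L N)\<^sup>2) * (\<Sum>i<N. \<Sum>j<N. F i * cnj (F j) * (if i = j then of_nat N else 0))"
  proof (rule arg_cong[where f = "(*) _"], intro sum.cong refl)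
    fix i j assume ij: "i \<in> {..<N}" "j \<in> {..<N}"
    have "(\<Sum>n\<in>modes. E n i * cnj (E n j)) = (\<Sum>n\<in>modes. exp (\<i> * of_real (2 * pi * of_int n * of_int (int j - int i) / real N)))"
      unfolding E_def exp_cnj exp_add[symmetric]
      by (intro sum.cong refl) (simp add: algebra_simps diff_divide_distrib)
    then show "F i * cnj (F j) * (\<Sum>n\<in>modes. E n i * cnj (E n j)) = F i * cnj (F j) * (if i = j then of_nat N else 0)"
      using ij by (simp only: sum_modes_exp dvd lessThan_iff)
  qed
  also have "\<dots> = of_real ((dx L N)\<^sup>2 * real N * (\<Sum>i<N. (cmod (F i))\<^sup>2))"
    by (simp only: of_real_mult of_real_sum complex_norm_square of_real_of_nat_eq)
      (simp add: sum_distrib_left sum_distrib_right mult_ac if_distrib cong: if_cong)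
  finally have "(\<Sum>n\<in>modes. (cmod (dft L N f (of_int n * dk L)))\<^sup>2) = (dx L N)\<^sup>2 * real N * (\<Sum>i<N. (cmod (F i))\<^sup>2)"
    using of_real_eq_iff by blast
  \<comment> \<open>The only place where the weights of the two norms meet: they leave the factor
    \<open>2 * pi\<close>.\<close>
  moreover have "dk L * ((dx L N)\<^sup>2 * real N) = 2 * pi * dx L N"
    using L_pos N_pos by (simp add: dk_def dx_def power2_eq_square)
  ultimately show ?thesis
    unfolding l2_norm_K_def l2_norm_X_def sum_Kgrid sum_Xgrid F_def
    by (simp add: real_sqrt_mult[symmetric] mult.assoc[symmetric])
qed

lemma dft_idft:
  assumes "k \<in> Kgrid L N"
  shows "dft L N (idft L N gh) k = gh k"
proof -
  obtain n where n: "n \<in> modes" "k = of_int n * dk L" using assms unfolding Kgrid_def by auto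
  have dvd: "int N dvd m - n \<longleftrightarrow> m = n" if "m \<in> modes" for m
  proof
    assume d: "int N dvd m - n"
    have "int N = 2 * (int N div 2)" using even_N by presburger
    then have "\<bar>m - n\<bar> < int N" using that n(1) by auto
    then show "m = n" using d zdvd_not_zless[of "\<bar>m - n\<bar>" "int N"] by (cases "m = n") auto
  qed simp
  have "dft L N (idft L N gh) k
      = (\<Sum>j<N. \<Sum>m\<in>modes. of_real (1 / real N) * gh (of_int m * dk L) * exp (\<i> * of_real (2 * pi * of_int (m - n) * real j / real N)))"
    unfolding dft_grid idft_def sum_Kgrid n(2) dk_dx
    unfolding sum_distrib_left
  proof (intro sum.cong refl, goal_cases)
    case (1 j m)
    have "complex_of_real (dx L N) * of_real (1 / L) = of_real (1 / real N)"
      using L_pos by (simp add: dx_def)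
    moreover have "exp (- \<i> * of_real (2 * pi * of_int n * real j / real N)) * exp (\<i> * of_real (2 * pi * of_int m * real j / real N))
       = exp (\<i> * of_real (2 * pi * of_int (m - n) * real j / real N))"
      unfolding exp_add[symmetric] by (simp add: algebra_simps diff_divide_distrib)
    moreover have "\<And>a b c d e :: complex. a * (b * (c * (d * e))) = (a * c) * e * (b * d)"
      by (simp only: mult_ac)
    ultimately show ?case by metis
  qed
  also have "\<dots> = (\<Sum>m\<in>modes. of_real (1 / real N) * gh (of_int m * dk L) * (\<Sum>j<N. exp (\<i> * of_real (2 * pi * of_int (m - n) * real j / real N))))"
    by (subst sum.swap) (simp only: sum_distrib_left)
  also have "\<dots> = (\<Sum>m\<in>modes. of_real (1 / real N) * gh (of_int m * dk L) * (if m = n then of_nat N else 0))"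
    by (intro sum.cong refl) (simp only: sum_exp_roots_of_unity[OF N_pos] dvd)
  also have "\<dots> = gh k"
    using n N_pos by (simp add: if_distrib cong: if_cong)
  finally show ?thesis .
qed

text \<open>At integer multiples of \<open>dk L\<close> each phase changes by whole turns. The
  restriction matters: at other real frequencies there is no such period.\<close>

lemma dft_periodic:
  "dft L N f (of_int n * dk L + real N * dk L) = dft L N f (of_int n * dk L)"
proof -
  have "exp (- \<i> * of_real (of_int (n + int N) * dk L * (real j * dx L N))) = exp (- \<i> * of_real (of_int n * dk L * (real j * dx L N)))" for j
    unfolding dk_dx exp_eq
    using N_pos by (auto intro!: exI[of _ "- int j"] simp: field_simps)
  then show ?thesis unfolding dft_grid by (simp add: distrib_right)
qed

lemma dft_shift:
  "dft L N f (k - c) = dft L N (\<lambda>x. exp (\<i> * of_real (c * x)) * f x) k"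
  unfolding dft_def
  by (intro arg_cong[where f = "(*) _"] sum.cong refl, unfold mult.assoc[symmetric] exp_add[symmetric]) (simp add: algebra_simps)

text \<open>The convolution theorem. No wrap-around of \<open>k - l\<close> is needed, because the
  transform is evaluated at every real frequency.\<close>

lemma dft_potential:
  "(\<Sum>l\<in>Kgrid L N. of_real (1 / L) * dft L N v (k - l) * f l) = dft L N (\<lambda>x. v x * idft L N f x) k"
proof -
  have "(\<Sum>l\<in>Kgrid L N. of_real (1 / L) * dft L N v (k - l) * f l)
     = (\<Sum>l\<in>Kgrid L N. \<Sum>x\<in>Xgrid L N. of_real (1 / L) * (of_real (dx L N) * ((exp (- \<i> * of_real (k * x)) * exp (\<i> * of_real (l * x))) * v x)) * f l)"
    unfolding dft_def sum_distrib_left sum_distrib_right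
    by (intro sum.cong refl) (simp add: exp_add[symmetric] algebra_simps)
  also have "\<dots> = dft L N (\<lambda>x. v x * idft L N f x) k"
    unfolding dft_def idft_def sum_distrib_left sum_distrib_right
    by (subst sum.swap) (intro sum.cong refl, simp add: mult_ac)
  finally show ?thesis .
qed

section \<open>Discrete norms and the operator norm\<close>

lemma l2_norm_K_nonneg: "0 \<le> l2_norm_K L N f"
  unfolding l2_norm_K_def using dk_pos by (simp add: sum_nonneg)

lemma l2_norm_K_cong:
  "(\<And>k. k \<in> Kgrid L N \<Longrightarrow> cmod (f k) = cmod (g k)) \<Longrightarrow> l2_norm_K L N f = l2_norm_K L N g"
  unfolding l2_norm_K_def by simp

lemma l2_norm_K_mono:
  assumes "\<And>k. k \<in> Kgrid L N \<Longrightarrow> cmod (f k) \<le> c * cmod (g k)" and "c \<ge> 0"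
  shows "l2_norm_K L N f \<le> c * l2_norm_K L N g"
proof -
  have "L2_set (\<lambda>k. cmod (f k)) (Kgrid L N) \<le> L2_set (\<lambda>k. c * cmod (g k)) (Kgrid L N)"
    by (intro L2_set_mono assms(1)) auto
  also have "\<dots> = c * L2_set (\<lambda>k. cmod (g k)) (Kgrid L N)"
    using assms(2) by (simp add: L2_set_right_distrib)
  finally show ?thesis
    unfolding l2_norm_K_eq_L2_set using dk_pos by (simp add: mult.left_commute)
qed

lemma l2_norm_K_add: "l2_norm_K L N (\<lambda>k. f k + g k) \<le> l2_norm_K L N f + l2_norm_K L N g"
proof -
  have "L2_set (\<lambda>k. cmod (f k + g k)) (Kgrid L N) \<le> L2_set (\<lambda>k. cmod (f k) + cmod (g k)) (Kgrid L N)"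
    by (intro L2_set_mono norm_triangle_ineq) auto
  also have "\<dots> \<le> L2_set (\<lambda>k. cmod (f k)) (Kgrid L N) + L2_set (\<lambda>k. cmod (g k)) (Kgrid L N)"
    by (rule L2_set_triangle_ineq)
  finally show ?thesis
    unfolding l2_norm_K_eq_L2_set using dk_pos by (simp flip: distrib_left)
qed

lemma l2_norm_K_sum:
  assumes "finite S"
  shows "l2_norm_K L N (\<lambda>k. \<Sum>j\<in>S. f j k) \<le> (\<Sum>j\<in>S. l2_norm_K L N (f j))"
  using assms
proof induction
  case empty
  show ?case by (simp add: l2_norm_K_def)
next
  case (insert j S)
  then show ?case using l2_norm_K_add[of "f j" "\<lambda>k. \<Sum>j\<in>S. f j k"] by simp
qed

lemma l2_norm_X_mono:
  assumes "\<And>x. x \<in> Xgrid L N \<Longrightarrow> cmod (f x) \<le> c * cmod (g x)" and "c \<ge> 0"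
  shows "l2_norm_X L N f \<le> c * l2_norm_X L N g"
proof -
  have "(\<Sum>x\<in>Xgrid L N. (cmod (f x))\<^sup>2) \<le> (\<Sum>x\<in>Xgrid L N. (c * cmod (g x))\<^sup>2)"
    by (intro sum_mono power_mono assms(1)) auto
  then have "dx L N * (\<Sum>x\<in>Xgrid L N. (cmod (f x))\<^sup>2) \<le> c\<^sup>2 * (dx L N * (\<Sum>x\<in>Xgrid L N. (cmod (g x))\<^sup>2))"
    using dx_pos by (simp add: power_mult_distrib sum_distrib_left[symmetric] mult.left_commute)
  then show ?thesis
    unfolding l2_norm_X_def using assms(2) real_sqrt_le_mono
    by (metis abs_of_nonneg real_sqrt_abs real_sqrt_mult)
qed

lemma mat_app_bound: "l2_norm_K L N (mat_app (Kgrid L N) G f) \<le> op_norm_K L N G * l2_norm_K L N f"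
proof -
  let ?K = "Kgrid L N"
  define M where "M = (\<Sum>k\<in>?K. \<Sum>l\<in>?K. cmod (G k l))"
  have M: "l2_norm_K L N (mat_app ?K G f) \<le> M * l2_norm_K L N f" for f
  proof -
    define n where "n = L2_set (\<lambda>k. cmod (f k)) ?K"
    have "L2_set (\<lambda>k. cmod (mat_app ?K G f k)) ?K \<le> (\<Sum>k\<in>?K. cmod (mat_app ?K G f k))"
      by (rule L2_set_le_sum) auto
    also have "\<dots> \<le> (\<Sum>k\<in>?K. \<Sum>l\<in>?K. cmod (G k l) * n)"
      unfolding mat_app_def n_def
      by (intro sum_mono order.trans[OF norm_sum]) (auto simp: norm_mult intro!: sum_mono mult_left_mono member_le_L2_set)
    also have "\<dots> = M * n" unfolding M_def by (simp add: sum_distrib_right)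
    finally show ?thesis
      unfolding l2_norm_K_eq_L2_set n_def using dk_pos by (simp add: mult.left_commute)
  qed
  have M0: "M \<ge> 0" unfolding M_def by (simp add: sum_nonneg)
  \<comment> \<open>The supremum dominates its members only once boundedness is known; the sum of
    the moduli of all entries is a crude bound.\<close>
  have bdd: "bdd_above (range (\<lambda>f. l2_norm_K L N (mat_app ?K G f) / l2_norm_K L N f))"
  proof (rule bdd_aboveI2)
    fix f
    show "l2_norm_K L N (mat_app ?K G f) / l2_norm_K L N f \<le> M"
      using M[of f] l2_norm_K_nonneg[of f] M0 by (cases "l2_norm_K L N f = 0") (auto simp: divide_le_eq)
  qed
  have q: "l2_norm_K L N (mat_app ?K G f) / l2_norm_K L N f \<le> op_norm_K L N G"
    unfolding op_norm_K_def by (rule cSUP_upper[OF _ bdd]) simp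
  show ?thesis
  proof (cases "l2_norm_K L N f = 0")
    \<comment> \<open>Here the quotient is 0 by convention and carries no information, so the crude
      bound is used directly.\<close>
    case True
    then show ?thesis using M[of f] by simp
  next
    case False
    then show ?thesis using q l2_norm_K_nonneg[of f] by (simp add: divide_le_eq)
  qed
qed

end

subsection \<open>Backward differences of the symbol\<close>

text \<open>The sign is opposite to the usual backward difference, so that multiplying by
  \<open>exp (\<i> * dk L * x) - 1\<close> needs no extra sign. The type covers both the real symbol
  and complex transforms.\<close>

definition bdiff :: "real \<Rightarrow> (real \<Rightarrow> 'a) \<Rightarrow> real \<Rightarrow> 'a::real_normed_field" where
  "bdiff \<delta> f k = (f (k - \<delta>) - f k) / of_real \<delta>"

lemma bdiff_funpow_Suc:
  "(bdiff \<delta> ^^ Suc m) f k = ((bdiff \<delta> ^^ m) f (k - \<delta>) - (bdiff \<delta> ^^ m) f k) / of_real \<delta>"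
  unfolding funpow.simps o_def by (rule bdiff_def)

text \<open>The stencil of an \<open>m\<close>-fold difference is \<open>k\<close>,
  \<open>k - \<delta>\<close>, ..., \<open>k - m * \<delta>\<close>. An equation valid on these
  points alone can therefore be differenced.\<close>

lemma bdiff_funpow_cong:
  assumes "\<And>i. i \<le> m \<Longrightarrow> f (k - real i * \<delta>) = g (k - real i * \<delta>)"
  shows "(bdiff \<delta> ^^ m) f k = (bdiff \<delta> ^^ m) g k"
  using assms
proof (induction m arbitrary: k)
  case 0
  show ?case using 0[of 0] by simp
next
  case (Suc m)
  have "(bdiff \<delta> ^^ m) f k = (bdiff \<delta> ^^ m) g k"
    by (rule Suc.IH) (simp add: Suc.prems)
  moreover have "(bdiff \<delta> ^^ m) f (k - \<delta>) = (bdiff \<delta> ^^ m) g (k - \<delta>)"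
    by (rule Suc.IH) (use Suc.prems[of "Suc _"] in \<open>simp add: algebra_simps\<close>)
  ultimately show ?case unfolding bdiff_funpow_Suc by simp
qed

lemma bdiff_funpow_diff:
  "(bdiff \<delta> ^^ m) (\<lambda>k. f k - g k) k = (bdiff \<delta> ^^ m) f k - (bdiff \<delta> ^^ m) g k"
  by (induction m arbitrary: k) (simp_all add: bdiff_funpow_Suc diff_divide_distrib del: funpow.simps(2))

lemma bdiff_funpow_scale:
  "(bdiff \<delta> ^^ m) (\<lambda>k. c * f k) k = c * (bdiff \<delta> ^^ m) f k"
  by (induction m arbitrary: k) (simp_all add: bdiff_funpow_Suc right_diff_distrib del: funpow.simps(2))

lemma bdiff_funpow_const: "(bdiff \<delta> ^^ Suc m) (\<lambda>k. c) k = 0"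
proof (induction m arbitrary: k)
  case 0
  show ?case by (simp add: bdiff_def)
next
  case (Suc m)
  then show ?case by (subst bdiff_funpow_Suc) (simp only: diff_self div_0)
qed

lemma bdiff_funpow_of_real:
  "(bdiff \<delta> ^^ m) (\<lambda>k. of_real (f k)) k = of_real ((bdiff \<delta> ^^ m) f k)"
  by (induction m arbitrary: k) (simp_all add: bdiff_funpow_Suc del: funpow.simps(2))

text \<open>Pascal's rule under the sum, as needed in the induction for the discrete Leibniz
  rule.\<close>

lemma sum_binomial_Suc:
  fixes c :: "nat \<Rightarrow> 'a::comm_ring_1"
  shows "(\<Sum>j\<le>m. of_nat (m choose j) * (c (Suc j) + c j)) = (\<Sum>j\<le>Suc m. of_nat (Suc m choose j) * c j)"
proof -
  have "(\<Sum>j\<le>Suc m. of_nat (Suc m choose j) * c j)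
     = c 0 + (\<Sum>j\<le>m. of_nat (m choose j) * c (Suc j) + of_nat (m choose Suc j) * c (Suc j))"
    by (subst sum.atMost_Suc_shift) (simp add: distrib_right)
  also have "\<dots> = (\<Sum>j\<le>m. of_nat (m choose j) * c (Suc j)) + (c 0 + (\<Sum>j\<le>m. of_nat (m choose Suc j) * c (Suc j)))"
    by (simp add: sum.distrib)
  also have "c 0 + (\<Sum>j\<le>m. of_nat (m choose Suc j) * c (Suc j)) = (\<Sum>j\<le>Suc m. of_nat (m choose j) * c j)"
    by (subst sum.atMost_Suc_shift) simp
  also have "\<dots> = (\<Sum>j\<le>m. of_nat (m choose j) * c j)" by (simp add: binomial_eq_0)
  finally show ?thesis by (simp add: distrib_left sum.distrib)
qed

text \<open>Iterates \<open>D(ab)(k) = Da(k) b(k - \<delta>) + a(k) Db(k)\<close>. All shifts fall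
  on \<open>b\<close>: with the symbol as \<open>a\<close>, its differences stay at \<open>k\<close>
  and can be compared with \<open>1 + h k\<close>.\<close>

lemma bdiff_funpow_mult:
  "(bdiff \<delta> ^^ m) (\<lambda>k. a k * b k) k
    = (\<Sum>j\<le>m. of_nat (m choose j) * ((bdiff \<delta> ^^ j) a k * (bdiff \<delta> ^^ (m - j)) b (k - real j * \<delta>)))"
proof (induction m arbitrary: k)
  case 0
  show ?case by simp
next
  case (Suc m)
  define c where "c j = (bdiff \<delta> ^^ j) a k * (bdiff \<delta> ^^ (Suc m - j)) b (k - real j * \<delta>)" for j
  have "(bdiff \<delta> ^^ Suc m) (\<lambda>k. a k * b k) k
     = (\<Sum>j\<le>m. of_nat (m choose j) * bdiff \<delta> (\<lambda>k. (bdiff \<delta> ^^ j) a k * (bdiff \<delta> ^^ (m - j)) b (k - real j * \<delta>)) k)"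
    unfolding bdiff_funpow_Suc Suc.IH bdiff_def[of \<delta> "\<lambda>k. _ k * _ k"]
    by (simp add: sum_subtractf[symmetric] sum_divide_distrib right_diff_distrib)
  also have "\<dots> = (\<Sum>j\<le>m. of_nat (m choose j) * (c (Suc j) + c j))"
  proof (intro sum.cong refl arg_cong[where f = "(*) _"])
    fix j assume "j \<in> {..m}"
    then have s: "Suc m - j = Suc (m - j)" by auto
    have "k - \<delta> - real j * \<delta> = k - real (Suc j) * \<delta>" "k - real j * \<delta> - \<delta> = k - real (Suc j) * \<delta>" by (simp_all add: algebra_simps)
    then show "bdiff \<delta> (\<lambda>k. (bdiff \<delta> ^^ j) a k * (bdiff \<delta> ^^ (m - j)) b (k - real j * \<delta>)) k = c (Suc j) + c j"
      unfolding c_def s bdiff_funpow_Suc bdiff_def[of \<delta> "\<lambda>k. _ k * _ k"]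
      by (simp add: diff_divide_distrib algebra_simps del: of_nat_Suc)
  qed
  also have "\<dots> = (\<Sum>j\<le>Suc m. of_nat (Suc m choose j) * c j)" by (rule sum_binomial_Suc)
  finally show ?case unfolding c_def .
qed

text \<open>\<open>F\<close> is a tower of successive derivatives. Differencing commutes with
  differentiation, so the mean value theorem trades one difference for one derivative, and the
  induction continues with the tower shifted by one at a point inside the stencil.\<close>

lemma bdiff_funpow_bound:
  fixes F :: "nat \<Rightarrow> real \<Rightarrow> real"
  assumes "\<delta> > 0"
    and "\<And>i x. (F i has_real_derivative F (Suc i) x) (at x)"
    and "\<And>x. k - real j * \<delta> \<le> x \<Longrightarrow> x \<le> k \<Longrightarrow> \<bar>F j x\<bar> \<le> B"
  shows "\<bar>(bdiff \<delta> ^^ j) (F 0) k\<bar> \<le> B"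
  using assms(2,3)
proof (induction j arbitrary: F k)
  case 0
  then show ?case by simp
next
  case (Suc j)
  have deriv: "((bdiff \<delta> ^^ i) (F 0) has_real_derivative (bdiff \<delta> ^^ i) (F 1) x) (at x)" for i x
  proof (induction i arbitrary: x)
    case 0
    show ?case using Suc.prems(1)[of 0] by simp
  next
    case (Suc i)
    have "((\<lambda>x. (bdiff \<delta> ^^ i) (F 0) (x - \<delta>)) has_real_derivative (bdiff \<delta> ^^ i) (F 1) (x - \<delta>)) (at x)"
      using DERIV_shift[of "(bdiff \<delta> ^^ i) (F 0)" _ x "- \<delta>"] Suc[of "x - \<delta>"] by simp
    then show ?case
      unfolding bdiff_funpow_Suc[abs_def] bdiff_funpow_Suc
      using assms(1) by (auto intro!: derivative_eq_intros Suc)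
  qed
  obtain \<xi> where \<xi>: "k - \<delta> < \<xi>" "\<xi> < k"
    "(bdiff \<delta> ^^ j) (F 0) k - (bdiff \<delta> ^^ j) (F 0) (k - \<delta>) = (k - (k - \<delta>)) * (bdiff \<delta> ^^ j) (F 1) \<xi>"
    using MVT2[of "k - \<delta>" k, OF _ deriv] assms(1) by auto
  have "(bdiff \<delta> ^^ Suc j) (F 0) k = - (bdiff \<delta> ^^ j) (F 1) \<xi>"
    using \<xi>(3) assms(1) unfolding bdiff_funpow_Suc by (simp add: field_simps)
  moreover have "\<bar>(bdiff \<delta> ^^ j) ((\<lambda>i. F (Suc i)) 0) \<xi>\<bar> \<le> B"
  proof (rule Suc.IH)
    show "\<bar>F (Suc j) x\<bar> \<le> B" if "\<xi> - real j * \<delta> \<le> x" "x \<le> \<xi>" for x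
      using that \<xi>(1,2) by (intro Suc.prems(2)) (auto simp: algebra_simps)
  qed (rule Suc.prems(1))
  ultimately show ?case by simp
qed

section \<open>Derivatives of the mollified symbol\<close>

lemma smooth_real_deriv:
  assumes "smooth_real f"
  shows "((deriv ^^ m) f has_real_derivative (deriv ^^ Suc m) f x) (at x)"
  using assms unfolding smooth_real_def funpow.simps o_def
  by (metis DERIV_deriv_iff_real_differentiable UNIV_I differentiable_on_def)

text \<open>The \<open>j\<close>-th derivative of \<open>hsym\<close> by the Leibniz rule; the truncated subtractions are harmless
  because their terms have coefficient \<open>0\<close>.\<close>

definition hsym_deriv :: "(real \<Rightarrow> real \<Rightarrow> real) \<Rightarrow> real \<Rightarrow> nat \<Rightarrow> real \<Rightarrow> real" where
  "hsym_deriv \<theta> kc j k = (if j = 0 then kc\<^sup>2 else 0) + (deriv ^^ j) (\<theta> kc) k * (k\<^sup>2 - kc\<^sup>2)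
     + 2 * real j * (deriv ^^ (j - 1)) (\<theta> kc) k * k
     + real j * (real j - 1) * (deriv ^^ (j - 2)) (\<theta> kc) k"

lemma hsym_deriv_0: "hsym_deriv \<theta> kc 0 = hsym \<theta> kc"
  by (simp add: hsym_deriv_def hsym_def fun_eq_iff)

lemma DERIV_hsym_deriv:
  assumes "smooth_real (\<theta> kc)"
  shows "(hsym_deriv \<theta> kc j has_real_derivative hsym_deriv \<theta> kc (Suc j) x) (at x)"
proof -
  note D = smooth_real_deriv[OF assms]
  \<comment> \<open>The first two cases are those where the orders \<open>j - 1\<close> or
    \<open>j - 2\<close> are truncated.\<close>
  consider "j = 0" | "j = 1" | i where "j = Suc (Suc i)" by (metis One_nat_def not0_implies_Suc)
  then show ?thesis
  proof cases
    case 1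
    then show ?thesis unfolding hsym_deriv_def[abs_def]
      using D[of 0] by (auto intro!: derivative_eq_intros)
  next
    case 2
    then show ?thesis unfolding hsym_deriv_def[abs_def]
      using D[of 0] D[of 1] by (auto intro!: derivative_eq_intros)
  next
    case (3 i)
    have "((\<lambda>k. a k * (k\<^sup>2 - kc\<^sup>2) + 2 * J * b k * k + J * (J - 1) * c k) has_real_derivative
        A * (x\<^sup>2 - kc\<^sup>2) + 2 * (J + 1) * a x * x + (J + 1) * J * b x) (at x)"
      if "(a has_real_derivative A) (at x)" "(b has_real_derivative a x) (at x)" "(c has_real_derivative b x) (at x)"
      for a b c :: "real \<Rightarrow> real" and A J
      using that by (auto intro!: derivative_eq_intros simp: algebra_simps)
    from this[OF D[of "Suc (Suc i)"] D[of "Suc i"] D[of i], of "real j"]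
    show ?thesis unfolding 3 hsym_deriv_def[abs_def] hsym_deriv_def
      by (simp del: funpow.simps add: add.commute)
  qed
qed

text \<open>The cut-off is constant near \<open>x\<close>; the strict inequality provides the open
  neighbourhood.\<close>

lemma admissible_cutoff_deriv_0:
  assumes "admissible_cutoffs Cth \<theta>" and "kc \<ge> pi" and "\<bar>x\<bar> < kc / 2"
  shows "(deriv ^^ Suc m) (\<theta> kc) x = 0"
  using assms(3)
proof (induction m arbitrary: x)
  case 0
  have "eventually (\<lambda>y. y \<in> {-kc/2<..<kc/2}) (nhds x)"
    using 0 by (intro eventually_nhds_in_open) auto
  then have "eventually (\<lambda>y. \<theta> kc y = 1) (nhds x)"
    by eventually_elim (use assms(1,2) in \<open>auto simp: admissible_cutoffs_def\<close>)
  then have "deriv (\<theta> kc) x = deriv (\<lambda>_. 1) x" by (rule deriv_cong_ev) simp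
  then show ?case by simp
next
  case (Suc m)
  have "eventually (\<lambda>y. y \<in> {-kc/2<..<kc/2}) (nhds x)"
    using Suc.prems by (intro eventually_nhds_in_open) auto
  then have "eventually (\<lambda>y. (deriv ^^ Suc m) (\<theta> kc) y = 0) (nhds x)"
    by eventually_elim (use Suc.IH in \<open>auto simp del: funpow.simps\<close>)
  then have "deriv ((deriv ^^ Suc m) (\<theta> kc)) x = deriv (\<lambda>_. 0) x" by (rule deriv_cong_ev) simp
  then show ?case by simp
qed

text \<open>The symbol is a convex combination of \<open>k\<^sup>2\<close> and
  \<open>kc\<^sup>2\<close>, and the latter is the larger one for these \<open>k\<close>.\<close>

lemma hsym_lower_bound:
  assumes "admissible_cutoffs Cth \<theta>" and "kc \<ge> pi" and "\<bar>k\<bar> \<le> kc"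
  shows "k\<^sup>2 \<le> hsym \<theta> kc k"
proof -
  have "\<theta> kc k \<le> 1" using assms(1,2) unfolding admissible_cutoffs_def by auto
  moreover have "k\<^sup>2 \<le> kc\<^sup>2" using assms by (simp add: abs_le_square_iff[symmetric])
  ultimately have "0 \<le> (1 - \<theta> kc k) * (kc\<^sup>2 - k\<^sup>2)" by simp
  then show ?thesis unfolding hsym_def by (simp add: algebra_simps)
qed

text \<open>Sum of the bounds from two regimes: \<open>4 * pi * j + 3\<close> where the symbol is
  exactly quadratic, and the Leibniz terms where \<open>x\<close> is at least
  \<open>kc / 2\<close>in modulus. The factor 8 comes from
  \<open>kc\<^sup>2 \<le> 8 * (1 + k\<^sup>2)\<close>.\<close>

definition hdiff_const :: "(nat \<Rightarrow> real) \<Rightarrow> nat \<Rightarrow> real" where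
  "hdiff_const Cth j = 4 * pi * real j + 3 + 8 * (2 * Cth j + 3 * real j * Cth (j - 1) + real j * (real j - 1) * Cth (j - 2))"

lemma Cth_nonneg:
  assumes "admissible_cutoffs Cth \<theta>"
  shows "Cth j \<ge> 0"
  using assms abs_ge_zero[THEN order.trans] unfolding admissible_cutoffs_def by (meson order_refl)

lemma hdiff_const_nonneg:
  assumes "admissible_cutoffs Cth \<theta>" and "j \<ge> 1"
  shows "hdiff_const Cth j \<ge> 0"
  unfolding hdiff_const_def using assms(2) Cth_nonneg[OF assms(1)] by auto

text \<open>Near \<open>k\<close> the symbol is either exactly quadratic, or \<open>k\<close> is comparable to \<open>kc\<close>: in the
  latter case the crude bound by \<open>kc\<^sup>2\<close> suffices.\<close>

lemma hsym_deriv_bound: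
  assumes adm: "admissible_cutoffs Cth \<theta>" and kc: "kc \<ge> pi" and k: "\<bar>k\<bar> \<le> kc"
    and j: "j \<ge> 1" and x: "\<bar>x - k\<bar> \<le> 2 * pi * real j" "\<bar>x - k\<bar> \<le> kc / 8"
  shows "\<bar>hsym_deriv \<theta> kc j x\<bar> \<le> hdiff_const Cth j * (1 + k\<^sup>2)"
proof -
  define R where "R = 2 * Cth j + 3 * real j * Cth (j - 1) + real j * (real j - 1) * Cth (j - 2)"
  note C0 = Cth_nonneg[OF adm]
  have R0: "R \<ge> 0" unfolding R_def using C0 j by auto
  have kc3: "kc \<ge> 3" using kc pi_gt3 by linarith
  show ?thesis
  proof (cases "\<bar>x\<bar> < kc / 2")
    case True
    have th0: "\<theta> kc x = 1" using adm kc True unfolding admissible_cutoffs_def by auto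
    have th: "(deriv ^^ i) (\<theta> kc) x = (if i = 0 then 1 else 0)" for i
      using th0 admissible_cutoff_deriv_0[OF adm kc True] by (cases i) (simp, simp only: nat.distinct if_False)
    have "hsym_deriv \<theta> kc j x = (if j = 1 then 2 * x else if j = 2 then 2 else 0)"
      unfolding hsym_deriv_def th using j by auto
    then have "\<bar>hsym_deriv \<theta> kc j x\<bar> \<le> 2 * \<bar>x\<bar> + 2" by auto
    also have "\<dots> \<le> 2 * \<bar>k\<bar> + 4 * pi * real j + 2" using x(1) by linarith
    \<comment> \<open>From \<open>(\<bar>k\<bar> - 1)\<^sup>2 \<ge> 0\<close>.\<close>
    also have "\<dots> \<le> (1 + k\<^sup>2) + (4 * pi * real j + 2) * 1"
      using zero_le_power2[of "\<bar>k\<bar> - 1"] by (simp add: power2_diff)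
    also have "\<dots> \<le> (1 + k\<^sup>2) + (4 * pi * real j + 2) * (1 + k\<^sup>2)"
      by (intro add_left_mono mult_left_mono) auto
    also have "\<dots> = (4 * pi * real j + 3) * (1 + k\<^sup>2)" by (simp add: algebra_simps)
    also have "\<dots> \<le> hdiff_const Cth j * (1 + k\<^sup>2)"
      unfolding hdiff_const_def R_def[symmetric] using R0 by (intro mult_right_mono) auto
    finally show ?thesis .
  next
    case False
    have ax: "\<bar>x\<bar> \<le> 9/8 * kc" using k x(2) by linarith
    have kc2: "kc \<le> kc\<^sup>2" "1 \<le> kc\<^sup>2" using kc3 power_mono[of 1 kc 2] by (auto simp: power2_eq_square)
    have "x\<^sup>2 \<le> (9/8 * kc)\<^sup>2" using ax kc3 by (intro abs_le_square_iff[THEN iffD1]) auto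
    then have q: "\<bar>x\<^sup>2 - kc\<^sup>2\<bar> \<le> 2 * kc\<^sup>2"
    proof -
      have "(9/8 * kc)\<^sup>2 = 81/64 * kc\<^sup>2" by (simp add: power_mult_distrib power_divide)
      then show ?thesis using \<open>x\<^sup>2 \<le> (9/8 * kc)\<^sup>2\<close> zero_le_power2[of x] zero_le_power2[of kc] by linarith
    qed
    have th: "\<bar>(deriv ^^ i) (\<theta> kc) x\<bar> \<le> Cth i" for i
      using adm kc unfolding admissible_cutoffs_def by blast
    have "\<bar>hsym_deriv \<theta> kc j x\<bar> \<le> \<bar>(deriv ^^ j) (\<theta> kc) x * (x\<^sup>2 - kc\<^sup>2)\<bar>
       + \<bar>2 * real j * (deriv ^^ (j - 1)) (\<theta> kc) x * x\<bar> + \<bar>real j * (real j - 1) * (deriv ^^ (j - 2)) (\<theta> kc) x\<bar>"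
      unfolding hsym_deriv_def using j by simp
    also have "\<dots> = \<bar>(deriv ^^ j) (\<theta> kc) x\<bar> * \<bar>x\<^sup>2 - kc\<^sup>2\<bar>
       + 2 * real j * \<bar>(deriv ^^ (j - 1)) (\<theta> kc) x\<bar> * \<bar>x\<bar> + real j * (real j - 1) * \<bar>(deriv ^^ (j - 2)) (\<theta> kc) x\<bar>"
      using j by (simp add: abs_mult)
    also have "\<dots> \<le> Cth j * (2 * kc\<^sup>2) + 2 * real j * Cth (j - 1) * (9/8 * kc\<^sup>2) + real j * (real j - 1) * Cth (j - 2)"
      using j C0 q ax kc2 th by (intro add_mono mult_mono mult_left_mono) auto
    \<comment> \<open>Rounding 9/8 up to 3/2 gives the coefficient 3 of \<open>hdiff_const\<close>;
      \<open>kc\<^sup>2 \<ge> 1\<close> absorbs the last term.\<close>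
    also have "\<dots> \<le> Cth j * (2 * kc\<^sup>2) + 2 * real j * Cth (j - 1) * (3/2 * kc\<^sup>2) + real j * (real j - 1) * Cth (j - 2) * kc\<^sup>2"
      using j C0 kc2 by (intro add_mono mult_left_mono order.refl mult_left_le[where c = "kc\<^sup>2"])
        (auto simp: mult_le_cancel_left1 mult_less_0_iff not_le[symmetric])
    also have "\<dots> = R * kc\<^sup>2" unfolding R_def by (simp add: algebra_simps)
    also have "\<dots> \<le> R * (8 * (1 + k\<^sup>2))"
    proof (rule mult_left_mono[OF _ R0])
      \<comment> \<open>\<open>1/2 - 1/8 = 3/8\<close>, and the resulting factor 64/9 is below
        8.\<close>
      have "3/8 * kc \<le> \<bar>k\<bar>" using False x(2) by linarith
      then have "(3/8 * kc)\<^sup>2 \<le> k\<^sup>2" using kc3 by (intro abs_le_square_iff[THEN iffD1]) auto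
      moreover have "(3/8 * kc)\<^sup>2 = 9/64 * kc\<^sup>2" by (simp add: power_mult_distrib power_divide)
      ultimately show "kc\<^sup>2 \<le> 8 * (1 + k\<^sup>2)" using zero_le_power2[of k] unfolding distrib_left by linarith
    qed
    also have "\<dots> \<le> hdiff_const Cth j * (1 + k\<^sup>2)"
      unfolding hdiff_const_def R_def[symmetric] by (simp add: algebra_simps)
    finally show ?thesis .
  qed
qed

lemma bdiff_hsym_bound:
  assumes adm: "admissible_cutoffs Cth \<theta>" and kc: "kc \<ge> pi" and k: "\<bar>k\<bar> \<le> kc"
    and j: "j \<ge> 1" and \<delta>: "0 < \<delta>" "\<delta> \<le> 2 * pi" "real j * \<delta> \<le> kc / 8"
  shows "\<bar>(bdiff \<delta> ^^ j) (hsym \<theta> kc) k\<bar> \<le> hdiff_const Cth j * (1 + hsym \<theta> kc k)"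
proof -
  have "smooth_real (\<theta> kc)" using adm kc unfolding admissible_cutoffs_def by blast
  then have "\<bar>(bdiff \<delta> ^^ j) (hsym_deriv \<theta> kc 0) k\<bar> \<le> hdiff_const Cth j * (1 + k\<^sup>2)"
  proof (intro bdiff_funpow_bound[OF \<delta>(1)] DERIV_hsym_deriv, assumption)
    fix x assume "k - real j * \<delta> \<le> x" "x \<le> k"
    moreover have "real j * \<delta> \<le> 2 * pi * real j" using \<delta>(2) using mult_right_mono[of \<delta> "2 * pi" "real j"] by (simp add: mult_ac)
    ultimately show "\<bar>hsym_deriv \<theta> kc j x\<bar> \<le> hdiff_const Cth j * (1 + k\<^sup>2)"
      using \<delta>(3) by (intro hsym_deriv_bound[OF adm kc k j]) auto
  qed
  also have "\<dots> \<le> hdiff_const Cth j * (1 + hsym \<theta> kc k)"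
    using hsym_lower_bound[OF adm kc k] hdiff_const_nonneg[OF adm j] by (simp add: mult_left_mono)
  finally show ?thesis unfolding hsym_deriv_0 .
qed

subsection \<open>Decay of the Green's function\<close>

text \<open>Jordan's inequality: the sine is concave here and lies above its chord.\<close>

lemma sin_ge_chord:
  assumes "0 \<le> t" and "t \<le> pi / 2"
  shows "2 / pi * t \<le> sin t"
proof -
  have "concave_on {0..pi / 2} sin"
    by (rule f''_le0_imp_concave[where f' = cos and f'' = "\<lambda>x. - sin x"])
      (auto intro!: derivative_eq_intros sin_ge_zero)
  from concave_onD_Icc'[OF this, of t] show ?thesis using assms by simp
qed

text \<open>Comparison with the integral of \<open>1 / (1 + t\<^sup>2)\<close>: by monotonicity each
  term with positive index is at most an increment of \<open>arctan\<close>, and negative indices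
  double it. The separate \<open>\<delta>\<close> is the term at 0.\<close>

lemma sum_resolvent_le_arctan:
  assumes "\<delta> > 0"
  shows "(\<Sum>n\<in>{- int M..int M}. \<delta> / (1 + (of_int n * \<delta>)\<^sup>2)) \<le> \<delta> + 2 * arctan (real M * \<delta>)"
proof (induction M)
  case 0
  show ?case by simp
next
  case (Suc M)
  let ?f = "\<lambda>n. \<delta> / (1 + (real_of_int n * \<delta>)\<^sup>2)"
  have "{- int (Suc M)..int (Suc M)} = insert (- int (Suc M)) (insert (int (Suc M)) {- int M..int M})"
    by auto
  then have "sum ?f {- int (Suc M)..int (Suc M)} = ?f (- int (Suc M)) + (?f (int (Suc M)) + sum ?f {- int M..int M})"
    by (simp only:) (subst sum.insert, force, force, subst sum.insert, auto)
  moreover have "?f (- int (Suc M)) = ?f (int (Suc M))"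
    by (simp only: of_int_minus mult_minus_left power2_minus)
  moreover have "?f (int (Suc M)) \<le> arctan (real (Suc M) * \<delta>) - arctan (real M * \<delta>)"
  proof -
    obtain z where z: "real M * \<delta> < z" "z < real (Suc M) * \<delta>"
      "arctan (real (Suc M) * \<delta>) - arctan (real M * \<delta>) = (real (Suc M) * \<delta> - real M * \<delta>) * inverse (1 + z\<^sup>2)"
      using MVT2[of "real M * \<delta>" "real (Suc M) * \<delta>" arctan, OF _ DERIV_arctan] assms by auto
    have "0 \<le> real M * \<delta>" using assms by simp
    then have "z\<^sup>2 \<le> (real (Suc M) * \<delta>)\<^sup>2" using z(1,2) by (intro power_mono) linarith+
    then have "\<delta> / (1 + (real (Suc M) * \<delta>)\<^sup>2) \<le> \<delta> / (1 + z\<^sup>2)"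
      using assms by (intro divide_left_mono mult_pos_pos add_pos_nonneg) auto
    also have "\<dots> = arctan (real (Suc M) * \<delta>) - arctan (real M * \<delta>)"
      unfolding z(3) by (simp add: divide_inverse algebra_simps)
    finally show ?thesis by simp
  qed
  ultimately show ?case using Suc.IH by linarith
qed

lemma mat_app_inverse:
  assumes "finite K" and "is_mat_inverse K A G" and "k \<in> K"
  shows "mat_app K G (mat_app K A w) k = w k"
proof -
  have "mat_app K G (mat_app K A w) k = (\<Sum>l\<in>K. (\<Sum>j\<in>K. G k j * A j l) * w l)"
    unfolding mat_app_def sum_distrib_left sum_distrib_right
    by (subst sum.swap) (simp add: mult.assoc)
  also have "\<dots> = (\<Sum>l\<in>K. kron k l * w l)"
    using assms(2,3) unfolding is_mat_inverse_def by (intro sum.cong) auto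
  also have "\<dots> = w k"
    using assms(1,3) by (simp add: kron_def if_distrib[of "\<lambda>c. c * _"] cong: if_cong)
  finally show ?thesis .
qed

section \<open>Fourier multipliers and isometries on the grid\<close>

context fourier_grid
begin

lemma dft_diff: "dft L N (\<lambda>x. f x - g x) k = dft L N f k - dft L N g k"
  unfolding dft_def by (simp add: sum_subtractf right_diff_distrib)

lemma dft_scale: "dft L N (\<lambda>x. c * f x) k = c * dft L N f k"
  unfolding dft_def by (simp add: sum_distrib_left mult_ac)

lemma dft_cong: "(\<And>x. x \<in> Xgrid L N \<Longrightarrow> f x = g x) \<Longrightarrow> dft L N f k = dft L N g k"
  unfolding dft_def by simp

lemma finite_Xgrid [simp]: "finite (Xgrid L N)"
  unfolding Xgrid_def by simp

lemma Xgrid_range: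
  assumes "x \<in> Xgrid L N"
  shows "0 \<le> x" "x < L"
  using assms L_pos N_pos unfolding Xgrid_def dx_def by (auto simp: field_simps)

lemma Kgrid_le_kcut:
  assumes "k \<in> Kgrid L N"
  shows "\<bar>k\<bar> \<le> kcut L N"
proof -
  obtain n where n: "n \<in> modes" "k = of_int n * dk L" using assms unfolding Kgrid_def by auto
  have "int N = 2 * (int N div 2)" using even_N by presburger
  then have "2 * \<bar>n\<bar> \<le> int N" using n(1) by auto
  then have "\<bar>real_of_int n\<bar> \<le> real N / 2" by linarith
  then show ?thesis
    unfolding n(2) kcut_eq abs_mult using dk_pos by (simp add: mult_right_mono)
qed

text \<open>The error has vanishing transform on the frequency grid by \<open>dft_idft\<close>, so
  Parseval makes it vanish on the space grid.\<close>

lemma idft_dft: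
  assumes "x \<in> Xgrid L N"
  shows "idft L N (dft L N f) x = f x"
proof -
  define e where "e x = f x - idft L N (dft L N f) x" for x
  have "dft L N e k = 0" if "k \<in> Kgrid L N" for k
    unfolding e_def dft_diff dft_idft[OF that] by simp
  then have "l2_norm_K L N (dft L N e) = 0"
    unfolding l2_norm_K_def by simp
  then have "(\<Sum>x\<in>Xgrid L N. (cmod (e x))\<^sup>2) = 0"
    unfolding parseval l2_norm_X_def using dx_pos by simp
  then have "e x = 0"
    using assms by (simp add: sum_nonneg_eq_0_iff)
  then show ?thesis by (simp add: e_def)
qed

lemma l2_norm_X_le_dft: "l2_norm_X L N f \<le> l2_norm_K L N (dft L N f)"
proof -
  have "1 \<le> sqrt (2 * pi)" using pi_gt3 by simp
  moreover have "0 \<le> l2_norm_X L N f"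
    unfolding l2_norm_X_def using dx_pos by (simp add: sum_nonneg)
  ultimately show ?thesis unfolding parseval by (simp add: mult_le_cancel_right1)
qed

text \<open>The shift is multiplication by a unimodular function in space, so Parseval applies even
  when \<open>k - c\<close> is off the grid.\<close>

lemma l2_norm_K_dft_shift:
  "l2_norm_K L N (\<lambda>k. dft L N f (k - c)) = l2_norm_K L N (dft L N f)"
proof -
  have "cmod (exp (\<i> * of_real (c * x))) = 1" for x by (rule norm_exp_i_times)
  then show ?thesis
    unfolding dft_shift parseval l2_norm_X_def norm_mult by simp
qed

text \<open>In space the potential acts by multiplication, where the pointwise bound suffices;
  Parseval is used in both directions and its factor cancels.\<close>

lemma potential_bound:
  assumes "\<And>x. x \<in> Xgrid L N \<Longrightarrow> cmod (v x) \<le> KV" and "KV \<ge> 0"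
  shows "l2_norm_K L N (dft L N (\<lambda>x. v x * idft L N f x)) \<le> KV * l2_norm_K L N f"
proof -
  have "l2_norm_X L N (\<lambda>x. v x * idft L N f x) \<le> KV * l2_norm_X L N (idft L N f)"
    using assms by (intro l2_norm_X_mono) (auto simp: norm_mult mult_right_mono)
  then have "l2_norm_K L N (dft L N (\<lambda>x. v x * idft L N f x)) \<le> KV * l2_norm_K L N (dft L N (idft L N f))"
    unfolding parseval by (simp add: mult.left_commute)
  also have "l2_norm_K L N (dft L N (idft L N f)) = l2_norm_K L N f"
    by (rule l2_norm_K_cong) (simp add: dft_idft)
  finally show ?thesis .
qed

text \<open>A complex substitute for the distance: multiplication by it is a backward difference in
  Fourier space.\<close>

definition circ :: "real \<Rightarrow> complex" where
  "circ x = (exp (\<i> * of_real (dk L * x)) - 1) / of_real (dk L)"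

lemma dft_circ_power: "dft L N (\<lambda>x. circ x ^ m * f x) = (bdiff (dk L) ^^ m) (dft L N f)"
proof (induction m)
  case 0
  show ?case by simp
next
  case (Suc m)
  have "dft L N (\<lambda>x. circ x * g x) k = bdiff (dk L) (dft L N g) k" for g k
  proof -
    have "circ x * g x = (1 / of_real (dk L)) * (exp (\<i> * of_real (dk L * x)) * g x - g x)" for x
      unfolding circ_def by (simp add: algebra_simps diff_divide_distrib)
    then show ?thesis
      unfolding bdiff_def dft_shift by (simp only: dft_scale dft_diff) simp
  qed
  from this[of "\<lambda>x. circ x ^ m * f x"] show ?case
    by (simp add: fun_eq_iff mult.assoc Suc.IH)
qed

text \<open>\<open>circ x\<close> has the length of a chord of the circle of circumference
  \<open>L\<close>, which is at least \<open>2 / pi\<close> times the arc by Jordan's inequality.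
  The symmetry of the sine about \<open>L / 2\<close> covers both branches of
  \<open>dist0\<close>.\<close>

lemma dist0_le_circ:
  assumes "x \<in> Xgrid L N"
  shows "0 \<le> dist0 L x" "dist0 L x \<le> pi / 2 * cmod (circ x)"
proof -
  note x = Xgrid_range[OF assms]
  show d0: "0 \<le> dist0 L x" using x unfolding dist0_def by auto
  have "pi * dist0 L x / L \<le> pi / 2"
    using x L_pos unfolding dist0_def by (auto simp: field_simps)
  then have "2 / pi * (pi * dist0 L x / L) \<le> sin (pi * dist0 L x / L)"
    using d0 L_pos by (intro sin_ge_chord) auto
  also have "\<dots> = sin (pi * x / L)"
  proof (cases "x < L / 2")
    case False
    have "pi * (L - x) / L = pi - pi * x / L" using L_pos by (simp add: field_simps)
    then show ?thesis using False by (simp add: dist0_def)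
  qed (simp add: dist0_def)
  also have "\<dots> \<le> \<bar>sin (dk L * x / 2)\<bar>"
    by (simp add: dk_def)
  finally have "2 * dist0 L x / L \<le> \<bar>sin (dk L * x / 2)\<bar>" by simp
  moreover have "cmod (circ x) = 2 * \<bar>sin (dk L * x / 2)\<bar> * L / (2 * pi)"
    unfolding circ_def norm_divide dist_exp_i_1 norm_of_real abs_of_pos[OF dk_pos] by (simp add: dk_def)
  ultimately show "dist0 L x \<le> pi / 2 * cmod (circ x)"
    using L_pos by (simp add: field_simps)
qed

end

text \<open>Each step is the elliptic estimate applied to the commutator terms, so the value
  involves no grid parameter. Its unconditional equation would loop as a rewrite rule.\<close>

function decay_const :: "real \<Rightarrow> (nat \<Rightarrow> real) \<Rightarrow> nat \<Rightarrow> real" where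
  "decay_const R A m = (if m = 0 then R * sqrt (3 * pi)
     else R * (\<Sum>j\<in>{1..m}. real (m choose j) * A j * decay_const R A (m - j)))"
  by auto
termination by (relation "Wellfounded.measure (\<lambda>(R, A, m). m)") auto

declare decay_const.simps [simp del]

section \<open>A priori estimates for the Green's operator\<close>

locale discrete_green = fourier_grid +
  fixes Cth \<theta> lam V KV KG G gh
  assumes adm: "admissible_cutoffs Cth \<theta>" and L_ge_1: "L \<ge> 1" and dx_le_1: "dx L N \<le> 1"
    and KV: "KV \<ge> 0" and V_le: "linf_norm_X L N (\<lambda>x. of_real (V x)) \<le> KV"
    and inverse: "is_mat_inverse (Kgrid L N) (\<lambda>k l. lam * kron k l - Hmat \<theta> L N V k l) G"
    and G_le: "op_norm_K L N G \<le> KG" and KG: "KG \<ge> 0"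
    and green: "\<And>k. k \<in> Kgrid L N \<Longrightarrow> lam * gh k - (\<Sum>l\<in>Kgrid L N. Hmat \<theta> L N V k l * gh l) = 1"
begin

abbreviation h :: "real \<Rightarrow> real" where
  "h \<equiv> hsym \<theta> (kcut L N)"

abbreviation potential :: "(real \<Rightarrow> complex) \<Rightarrow> real \<Rightarrow> complex" where
  "potential w \<equiv> dft L N (\<lambda>x. of_real (V x) * idft L N w x)"

text \<open>The norm bound in the elliptic estimate: 1 for the free part, the rest for its
  correction by the Green's function.\<close>

definition R :: real where
  "R = 1 + KG * (cmod lam + 1 + KV)"

lemma R_nonneg: "R \<ge> 0"
  unfolding R_def using KG KV by simp

lemma kcut_ge_pi: "kcut L N \<ge> pi"
  unfolding kcut_def using dx_le_1 dx_pos by (simp add: field_simps)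

lemma h_ge_square: "k \<in> Kgrid L N \<Longrightarrow> k\<^sup>2 \<le> h k"
  by (rule hsym_lower_bound[OF adm kcut_ge_pi Kgrid_le_kcut])

lemma h_pos: "k \<in> Kgrid L N \<Longrightarrow> 0 < 1 + h k"
  using h_ge_square[of k] zero_le_power2[of k] by linarith

lemma V_bound:
  assumes "x \<in> Xgrid L N"
  shows "cmod (of_real (V x)) \<le> KV"
  using V_le assms unfolding linf_norm_X_def by (intro order.trans[OF Max_ge V_le[unfolded linf_norm_X_def]]) auto

lemma Hmat_apply:
  assumes "k \<in> Kgrid L N"
  shows "(\<Sum>l\<in>Kgrid L N. Hmat \<theta> L N V k l * w l) = of_real (h k) * w k + potential w k"
proof -
  have "(\<Sum>l\<in>Kgrid L N. of_real (h k) * kron k l * w l) = of_real (h k) * w k"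
    using assms by (simp add: kron_def if_distrib[of "\<lambda>c. _ * c"] if_distrib[of "\<lambda>c. c * _"] cong: if_cong)
  then show ?thesis
    unfolding Hmat_def distrib_right sum.distrib dft_potential by simp
qed

lemma resolvent_bound:
  assumes "\<And>k. k \<in> Kgrid L N \<Longrightarrow> lam * w k - of_real (h k) * w k - potential w k = F k"
  shows "l2_norm_K L N w \<le> KG * l2_norm_K L N F"
proof -
  have "mat_app (Kgrid L N) (\<lambda>k l. lam * kron k l - Hmat \<theta> L N V k l) w k = F k" if k: "k \<in> Kgrid L N" for k
  proof -
    have "(\<Sum>l\<in>Kgrid L N. lam * kron k l * w l) = lam * w k"
      using k by (simp add: kron_def if_distrib[of "\<lambda>c. _ * c"] if_distrib[of "\<lambda>c. c * _"] cong: if_cong)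
    then show ?thesis
      unfolding mat_app_def left_diff_distrib sum_subtractf Hmat_apply[OF k] assms[OF k, symmetric] by simp
  qed
  then have "mat_app (Kgrid L N) G F k = w k" if "k \<in> Kgrid L N" for k
    using mat_app_inverse[OF finite_Kgrid inverse that, of w] by (simp add: mat_app_def)
  then have "l2_norm_K L N w = l2_norm_K L N (mat_app (Kgrid L N) G F)"
    by (intro l2_norm_K_cong) simp
  also have "\<dots> \<le> op_norm_K L N G * l2_norm_K L N F" by (rule mat_app_bound)
  also have "\<dots> \<le> KG * l2_norm_K L N F" by (rule mult_right_mono[OF G_le l2_norm_K_nonneg])
  finally show ?thesis .
qed

text \<open>The Green's function gains two derivatives uniformly in the cut-off: subtracting the
  solution of the free equation leaves a right-hand side that is bounded in \<open>L\<^sup>2\<close>.\<close>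

lemma elliptic_bound:
  assumes w: "\<And>k. k \<in> Kgrid L N \<Longrightarrow> lam * w k - of_real (h k) * w k - potential w k = F k"
  shows "l2_norm_K L N w \<le> R * l2_norm_K L N (\<lambda>k. F k / of_real (1 + h k))"
proof -
  \<comment> \<open>\<open>- u\<close> solves the free equation at energy -1, where the denominator
    is positive. The remainder \<open>w + u\<close> then has the right-hand side \<open>r\<close>,
    free of the symbol.\<close>
  define u where "u k = F k / of_real (1 + h k)" for k
  define r where "r k = (lam + 1) * u k + - potential u k" for k
  have Hlin: "potential (\<lambda>k. w k + u k) k = potential w k + potential u k" for k
    by (simp add: dft_potential[symmetric] distrib_left sum.distrib)
  have "l2_norm_K L N (\<lambda>k. w k + u k) \<le> KG * l2_norm_K L N r"
  proof (rule resolvent_bound)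
    fix k assume k: "k \<in> Kgrid L N"
    have "F k = of_real (1 + h k) * u k"
      unfolding u_def using h_pos[OF k] by (simp del: of_real_add)
    then show "lam * (w k + u k) - of_real (h k) * (w k + u k) - potential (\<lambda>k. w k + u k) k = r k"
      unfolding Hlin r_def using w[OF k] by (simp add: algebra_simps)
  qed
  also have "l2_norm_K L N r \<le> (cmod lam + 1) * l2_norm_K L N u + KV * l2_norm_K L N u"
  proof -
    have "cmod ((lam + 1) * u k) \<le> (cmod lam + 1) * cmod (u k)" for k
      unfolding norm_mult using norm_triangle_ineq[of lam 1] by (intro mult_right_mono) auto
    then have "l2_norm_K L N (\<lambda>k. (lam + 1) * u k) \<le> (cmod lam + 1) * l2_norm_K L N u"
      by (intro l2_norm_K_mono) auto
    moreover have "l2_norm_K L N (potential u) \<le> KV * l2_norm_K L N u"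
      by (rule potential_bound[OF V_bound KV])
    moreover have "l2_norm_K L N (\<lambda>k. - potential u k) = l2_norm_K L N (potential u)"
      by (rule l2_norm_K_cong) simp
    ultimately show ?thesis
      unfolding r_def using l2_norm_K_add[of "\<lambda>k. (lam + 1) * u k" "\<lambda>k. - potential u k"] by linarith
  qed
  finally have z: "l2_norm_K L N (\<lambda>k. w k + u k) \<le> KG * ((cmod lam + 1) * l2_norm_K L N u + KV * l2_norm_K L N u)"
    using KG by (simp add: mult_left_mono)
  have "l2_norm_K L N w = l2_norm_K L N (\<lambda>k. (w k + u k) + - u k)" by simp
  also have "\<dots> \<le> l2_norm_K L N (\<lambda>k. w k + u k) + l2_norm_K L N (\<lambda>k. - u k)" by (rule l2_norm_K_add)
  also have "l2_norm_K L N (\<lambda>k. - u k) = l2_norm_K L N u" by (rule l2_norm_K_cong) simp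
  finally show ?thesis
    using z unfolding R_def u_def[symmetric] by (simp add: algebra_simps)
qed

section \<open>Differenced equation and weighted bounds\<close>

definition g :: "nat \<Rightarrow> real \<Rightarrow> complex" where
  "g m x = circ x ^ m * idft L N gh x"

lemma dft_g: "dft L N (g m) = (bdiff (dk L) ^^ m) (dft L N (idft L N gh))"
  unfolding g_def[abs_def] by (rule dft_circ_power)

text \<open>Off the grid \<open>gh\<close> is arbitrary. Replacing it by the transform of its
  inverse keeps the equation on the grid and gives the periodic extension required by difference
  stencils.\<close>

lemma green_Kgrid:
  assumes "k \<in> Kgrid L N"
  shows "lam * dft L N (idft L N gh) k - of_real (h k) * dft L N (idft L N gh) k
    - dft L N (\<lambda>x. of_real (V x) * idft L N gh x) k = 1"
  using green[OF assms] unfolding Hmat_apply[OF assms] dft_idft[OF assms] by (simp add: algebra_simps)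

text \<open>The symbol is constant beyond \<open>3/4\<close> of the cut-off, hence the periodic extension of the
  equation still holds with \<^const>\<open>hsym\<close> itself slightly to the left of the grid.\<close>

lemma green_extended:
  assumes "k \<in> Kgrid L N" and "real i \<le> real N / 16"
  defines "k' \<equiv> k - real i * dk L"
  shows "lam * dft L N (idft L N gh) k' - of_real (h k') * dft L N (idft L N gh) k'
    - dft L N (\<lambda>x. of_real (V x) * idft L N gh x) k' = 1"
proof -
  obtain n where n: "n \<in> modes" "k = of_int n * dk L" using assms(1) unfolding Kgrid_def by auto
  have N2: "int N = 2 * (int N div 2)" using even_N by presburger
  have i: "16 * int i \<le> int N" using assms(2) by linarith
  have k': "k' = of_int (n - int i) * dk L" unfolding k'_def n(2) by (simp add: algebra_simps)
  show ?thesis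
  proof (cases "n - int i \<in> modes")
    case True
    then have "k' \<in> Kgrid L N" unfolding k' Kgrid_def by blast
    then show ?thesis by (rule green_Kgrid)
  next
    case False
    \<comment> \<open>Moving left leaves the grid only at its lower end; adding one period returns
      to it.\<close>
    then have le: "n - int i \<le> - (int N div 2)" using n(1) by auto
    define k'' where "k'' = of_int (n - int i) * dk L + real N * dk L"
    have k''2: "k'' = of_int (n - int i + int N) * dk L" unfolding k''_def by (simp add: algebra_simps)
    have "n - int i + int N \<in> modes" using le n(1) i N2 by auto
    then have "k'' \<in> Kgrid L N" unfolding k''2 Kgrid_def by blast
    note eq = green_Kgrid[OF this]
    have flat: "h y = (kcut L N)\<^sup>2" if "3 / 4 * kcut L N \<le> \<bar>y\<bar>" for y
      using that adm kcut_ge_pi unfolding hsym_def admissible_cutoffs_def by simp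
    have "h k' = h k''"
    proof -
      have "int N div 2 \<le> \<bar>n - int i\<bar>" using le by arith
      then have "2 * \<bar>n - int i\<bar> \<ge> int N" using N2 by arith
      then have "real_of_int (int N) \<le> real_of_int (2 * \<bar>n - int i\<bar>)" by (simp only: of_int_le_iff)
      then have "3 / 4 * (real N / 2) \<le> \<bar>real_of_int (n - int i)\<bar>" by simp
      then have "3 / 4 * kcut L N \<le> \<bar>k'\<bar>"
        unfolding k' kcut_eq abs_mult using dk_pos mult_right_mono[of _ _ "dk L"] by fastforce
      \<comment> \<open>From \<open>n \<ge> - N / 2 + 1\<close> and \<open>i \<le> N / 16\<close>
        the wrapped index exceeds \<open>7 * N / 16\<close>, hence lies beyond
        \<open>3 * N / 8\<close>, where the symbol is constant.\<close>
      moreover have "3 * int N \<le> 8 * \<bar>n - int i + int N\<bar>" using n(1) i N2 by auto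
      then have "real_of_int (3 * int N) \<le> real_of_int (8 * \<bar>n - int i + int N\<bar>)" by (simp only: of_int_le_iff)
      then have "3 / 4 * (real N / 2) \<le> \<bar>real_of_int (n - int i + int N)\<bar>" by simp
      then have "3 / 4 * kcut L N \<le> \<bar>k''\<bar>"
        unfolding k''2 kcut_eq abs_mult using dk_pos mult_right_mono[of _ _ "dk L"] by fastforce
      ultimately show ?thesis by (simp add: flat)
    qed
    moreover have "dft L N f k'' = dft L N f k'" for f
      unfolding k''_def k' by (rule dft_periodic)
    ultimately show ?thesis using eq by simp
  qed
qed

text \<open>The \<open>m\<close>-th difference of the equation: the commutator of \<open>circ\<^sup>m\<close> with the symbol has
  only terms with a lower power of \<open>circ\<close>.\<close>

lemma green_differenced:
  assumes k: "k \<in> Kgrid L N" and m: "m \<ge> 1" "real m \<le> real N / 16"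
  shows "lam * dft L N (g m) k - of_real (h k) * dft L N (g m) k - potential (dft L N (g m)) k
    = (\<Sum>j\<in>{1..m}. of_nat (m choose j) * (of_real ((bdiff (dk L) ^^ j) h k) * dft L N (g (m - j)) (k - real j * dk L)))"
proof -
  define f where "f = dft L N (idft L N gh)"
  define v where "v = dft L N (\<lambda>x. of_real (V x) * idft L N gh x)"
  define hc where "hc k = complex_of_real (h k)" for k
  let ?D = "\<lambda>i. bdiff (dk L) ^^ i"
  have "?D m (\<lambda>k. (lam * f k - hc k * f k) - v k) k = ?D m (\<lambda>k. 1) k"
  proof (rule bdiff_funpow_cong)
    fix i assume "i \<le> m"
    then have "real i \<le> real N / 16" using m(2) by linarith
    from green_extended[OF k this]
    show "lam * f (k - real i * dk L) - hc (k - real i * dk L) * f (k - real i * dk L) - v (k - real i * dk L) = 1"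
      unfolding f_def v_def hc_def .
  qed
  also have "\<dots> = 0" using m(1) bdiff_funpow_const[of "m - 1" "dk L" 1 k] by (simp del: funpow.simps)
  finally have "lam * ?D m f k - ?D m (\<lambda>k. hc k * f k) k - ?D m v k = 0"
    unfolding bdiff_funpow_diff bdiff_funpow_scale .
  \<comment> \<open>The Leibniz term \<open>j = 0\<close> is the symbol acting on
    \<open>g m\<close>; the others form the commutator.\<close>
  moreover have "?D m (\<lambda>k. hc k * f k) k = hc k * ?D m f k
     + (\<Sum>j\<in>{1..m}. of_nat (m choose j) * (?D j hc k * ?D (m - j) f (k - real j * dk L)))"
    unfolding bdiff_funpow_mult atMost_atLeast0 sum.atLeast_Suc_atMost[OF le0] by simp
  moreover have "?D j hc k = of_real (?D j h k)" for j
    unfolding hc_def[abs_def] by (rule bdiff_funpow_of_real)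
  moreover have "?D m v k = potential (dft L N (g m)) k"
  proof -
    have "?D m v = dft L N (\<lambda>x. circ x ^ m * (of_real (V x) * idft L N gh x))"
      unfolding v_def dft_circ_power ..
    \<comment> \<open>Since \<open>idft\<close> inverts \<open>dft\<close> on the grid, the
      potential commutes with \<open>circ x ^ m\<close>.\<close>
    moreover have "potential (dft L N (g m)) k = dft L N (\<lambda>x. circ x ^ m * (of_real (V x) * idft L N gh x)) k"
      by (rule dft_cong) (simp add: idft_dft g_def mult_ac)
    ultimately show ?thesis by simp
  qed
  ultimately show ?thesis
    unfolding dft_g f_def[symmetric] hc_def by (simp add: algebra_simps)
qed

lemma dk_le: "dk L \<le> 2 * pi"
  using L_ge_1 by (simp add: dk_def field_simps)

text \<open>The bound \<open>1 + h k \<ge> 1 + k\<^sup>2\<close> leads to a Riemann sum: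
  \<open>dk L\<close> contributes at most \<open>2 * pi\<close>, as \<open>L \<ge> 1\<close>, and
  twice the arctangent at most \<open>pi\<close>.\<close>

lemma delta_norm_bound: "l2_norm_K L N (\<lambda>k. 1 / of_real (1 + h k)) \<le> sqrt (3 * pi)"
proof -
  let ?f = "\<lambda>n. dk L / (1 + (real_of_int n * dk L)\<^sup>2)"
  have "dk L * (\<Sum>k\<in>Kgrid L N. (cmod (1 / of_real (1 + h k)))\<^sup>2) \<le> dk L * (\<Sum>k\<in>Kgrid L N. 1 / (1 + k\<^sup>2))"
  proof (intro mult_left_mono sum_mono)
    fix k assume k: "k \<in> Kgrid L N"
    have h: "1 + k\<^sup>2 \<le> 1 + h k" and k0: "0 < 1 + k\<^sup>2"
      using h_ge_square[OF k] by (auto intro: add_pos_nonneg)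
    have "(cmod (1 / of_real (1 + h k)))\<^sup>2 = (1 / (1 + h k))\<^sup>2"
      unfolding norm_divide norm_of_real using h_pos[OF k] by simp
    also have "\<dots> \<le> (1 / (1 + k\<^sup>2))\<^sup>2"
      using h k0 h_pos[OF k] by (intro power_mono divide_left_mono) auto
    also have "\<dots> \<le> 1 / (1 + k\<^sup>2)"
      unfolding power2_eq_square[of "1 / _"] using k0 by (intro mult_left_le) (auto simp: divide_le_eq)
    finally show "(cmod (1 / of_real (1 + h k)))\<^sup>2 \<le> 1 / (1 + k\<^sup>2)" .
  qed (use dk_pos in auto)
  also have "\<dots> = sum ?f modes"
    unfolding sum_Kgrid sum_distrib_left by simp
  \<comment> \<open>Enlarges \<open>modes\<close> to the symmetric range of the arctangent
    estimate.\<close>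
  also have "\<dots> \<le> sum ?f {- int N..int N}"
    using dk_pos by (intro sum_mono2) (auto intro!: divide_nonneg_pos add_pos_nonneg)
  also have "\<dots> \<le> dk L + 2 * arctan (real N * dk L)"
    by (rule sum_resolvent_le_arctan[OF dk_pos])
  also have "\<dots> \<le> 3 * pi"
    using dk_le arctan_ubound[of "real N * dk L"] by linarith
  finally show ?thesis
    unfolding l2_norm_K_def by (rule real_sqrt_le_mono)
qed

text \<open>The induction is strong because the commutator for \<open>g m\<close> involves every
  \<open>g (m - j)\<close> with \<open>1 \<le> j \<le> m\<close>.\<close>

lemma dft_g_bound:
  assumes "real m \<le> real N / 16"
  shows "l2_norm_K L N (dft L N (g m)) \<le> decay_const R (hdiff_const Cth) m"
  using assms
proof (induction m rule: less_induct)
  case (less m)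
  show ?case
  proof (cases "m = 0")
    case True
    have g0: "g 0 = idft L N gh" by (simp add: g_def fun_eq_iff)
    have "l2_norm_K L N (dft L N (g 0)) \<le> R * l2_norm_K L N (\<lambda>k. 1 / of_real (1 + h k))"
    proof (rule elliptic_bound)
      fix k assume k: "k \<in> Kgrid L N"
      have "potential (dft L N (g 0)) k = dft L N (\<lambda>x. of_real (V x) * idft L N gh x) k"
        unfolding g0 by (rule dft_cong) (simp add: idft_dft)
      then show "lam * dft L N (g 0) k - of_real (h k) * dft L N (g 0) k - potential (dft L N (g 0)) k = 1"
        using green_Kgrid[OF k] by (simp only: g0)
    qed
    also have "\<dots> \<le> R * sqrt (3 * pi)"
      by (rule mult_left_mono[OF delta_norm_bound R_nonneg])
    finally show ?thesis using True by (subst decay_const.simps) simp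
  next
    case False
    then have m1: "m \<ge> 1" by simp
    let ?t = "\<lambda>j k. of_nat (m choose j) * (of_real ((bdiff (dk L) ^^ j) h k) * dft L N (g (m - j)) (k - real j * dk L)) / of_real (1 + h k)"
    have "l2_norm_K L N (dft L N (g m)) \<le> R * l2_norm_K L N (\<lambda>k. \<Sum>j\<in>{1..m}. ?t j k)"
      using elliptic_bound[OF green_differenced[OF _ m1 less.prems]] by (simp add: sum_divide_distrib)
    also have "l2_norm_K L N (\<lambda>k. \<Sum>j\<in>{1..m}. ?t j k) \<le> (\<Sum>j\<in>{1..m}. l2_norm_K L N (?t j))"
      by (rule l2_norm_K_sum) simp
    also have "\<dots> \<le> (\<Sum>j\<in>{1..m}. real (m choose j) * hdiff_const Cth j * decay_const R (hdiff_const Cth) (m - j))"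
    proof (rule sum_mono)
      fix j assume "j \<in> {1..m}"
      then have j: "1 \<le> j" "j \<le> m" by auto
      have jN: "real j \<le> real N / 16" using j less.prems by linarith
      have c0: "0 \<le> real (m choose j) * hdiff_const Cth j"
        using hdiff_const_nonneg[OF adm j(1)] by simp
      have "l2_norm_K L N (?t j) \<le> (real (m choose j) * hdiff_const Cth j) * l2_norm_K L N (\<lambda>k. dft L N (g (m - j)) (k - real j * dk L))"
      proof (rule l2_norm_K_mono[OF _ c0])
        fix k assume k: "k \<in> Kgrid L N"
        have "real j * dk L \<le> kcut L N / 8"
          unfolding kcut_eq using mult_right_mono[OF jN, of "dk L"] dk_pos by simp
        then have "\<bar>(bdiff (dk L) ^^ j) h k\<bar> \<le> hdiff_const Cth j * (1 + h k)"
          by (rule bdiff_hsym_bound[OF adm kcut_ge_pi Kgrid_le_kcut[OF k] j(1) dk_pos dk_le])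
        then have "\<bar>(bdiff (dk L) ^^ j) h k\<bar> / (1 + h k) \<le> hdiff_const Cth j"
          using h_pos[OF k] by (simp add: divide_le_eq)
        from mult_left_mono[OF mult_right_mono[OF this norm_ge_zero[of "dft L N (g (m - j)) (k - real j * dk L)"]], of "real (m choose j)"]
        show "cmod (?t j k) \<le> real (m choose j) * hdiff_const Cth j * cmod (dft L N (g (m - j)) (k - real j * dk L))"
          unfolding norm_divide norm_mult norm_of_real norm_of_nat using h_pos[OF k] by (simp add: mult_ac)
      qed
      also have "\<dots> = (real (m choose j) * hdiff_const Cth j) * l2_norm_K L N (dft L N (g (m - j)))"
        unfolding l2_norm_K_dft_shift ..
      also have "\<dots> \<le> (real (m choose j) * hdiff_const Cth j) * decay_const R (hdiff_const Cth) (m - j)"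
        using j less.prems by (intro mult_left_mono[OF less.IH c0]) auto
      finally show "l2_norm_K L N (?t j) \<le> real (m choose j) * hdiff_const Cth j * decay_const R (hdiff_const Cth) (m - j)" .
    qed
    finally show ?thesis
      using False R_nonneg by (subst decay_const.simps) (simp add: mult_left_mono)
  qed
qed

lemma dist0_power_bound:
  assumes "real m \<le> real N / 16"
  shows "l2_norm_X L N (\<lambda>x. of_real (dist0 L x ^ m) * idft L N gh x) \<le> (pi / 2) ^ m * decay_const R (hdiff_const Cth) m"
proof -
  have "l2_norm_X L N (\<lambda>x. of_real (dist0 L x ^ m) * idft L N gh x) \<le> (pi / 2) ^ m * l2_norm_X L N (g m)"
  proof (rule l2_norm_X_mono)
    fix x assume x: "x \<in> Xgrid L N"
    have "dist0 L x ^ m \<le> (pi / 2 * cmod (circ x)) ^ m"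
      by (rule power_mono) (rule dist0_le_circ[OF x])+
    from mult_right_mono[OF this norm_ge_zero[of "idft L N gh x"]]
    show "cmod (of_real (dist0 L x ^ m) * idft L N gh x) \<le> (pi / 2) ^ m * cmod (g m x)"
      unfolding g_def norm_mult norm_power norm_of_real power_mult_distrib
      using dist0_le_circ(1)[OF x] by (simp add: mult_ac)
  qed simp
  also have "\<dots> \<le> (pi / 2) ^ m * decay_const R (hdiff_const Cth) m"
    using order.trans[OF l2_norm_X_le_dft dft_g_bound[OF assms]] by (intro mult_left_mono) auto
  finally show ?thesis .
qed

end

theorem theorem3p7:
  fixes lam :: complex and KV KG :: real and Cth :: "nat \<Rightarrow> real"
  assumes "KV > 0" and "KG > 0"
  shows "\<exists>C :: nat \<Rightarrow> real.
    \<forall>\<theta>. admissible_cutoffs Cth \<theta> \<longrightarrow>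
    (\<forall>(L :: real) (N :: nat) (V :: real \<Rightarrow> real)
       (G :: real \<Rightarrow> real \<Rightarrow> complex) (gh :: real \<Rightarrow> complex).
       L \<ge> 1 \<longrightarrow> N \<ge> 32 \<longrightarrow> even N \<longrightarrow> dx L N \<le> 1 \<longrightarrow>
       linf_norm_X L N (\<lambda>x. of_real (V x)) \<le> KV \<longrightarrow>
       is_mat_inverse (Kgrid L N) (\<lambda>k l. lam * kron k l - Hmat \<theta> L N V k l) G \<longrightarrow>
       op_norm_K L N G \<le> KG \<longrightarrow>
       (\<forall>k\<in>Kgrid L N. lam * gh k - (\<Sum>l\<in>Kgrid L N. Hmat \<theta> L N V k l * gh l) = 1) \<longrightarrow>
       (\<forall>m :: nat. real m \<le> real N / 16 \<longrightarrow>
          l2_norm_X L N (\<lambda>x. of_real (dist0 L x ^ m) * idft L N gh x) \<le> C m))"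
proof (intro exI allI impI)
  fix \<theta> and L :: real and N :: nat and V :: "real \<Rightarrow> real" and G :: "real \<Rightarrow> real \<Rightarrow> complex"
    and gh :: "real \<Rightarrow> complex" and m :: nat
  assume *: "admissible_cutoffs Cth \<theta>" "L \<ge> 1" "N \<ge> 32" "even N" "dx L N \<le> 1"
    "linf_norm_X L N (\<lambda>x. of_real (V x)) \<le> KV"
    "is_mat_inverse (Kgrid L N) (\<lambda>k l. lam * kron k l - Hmat \<theta> L N V k l) G"
    "op_norm_K L N G \<le> KG"
    "\<forall>k\<in>Kgrid L N. lam * gh k - (\<Sum>l\<in>Kgrid L N. Hmat \<theta> L N V k l * gh l) = 1"
    and m: "real m \<le> real N / 16"
  interpret discrete_green L N Cth \<theta> lam V KV KG G gh
    using * assms by unfold_locales auto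
  \<comment> \<open>This fixes the constant, left open so far; with \<open>R\<close> unfolded it
    visibly contains only \<open>m\<close>, \<open>lam\<close>, \<open>KV\<close>, \<open>KG\<close>
    and \<open>Cth\<close>.\<close>
  show "l2_norm_X L N (\<lambda>x. of_real (dist0 L x ^ m) * idft L N gh x)
      \<le> (pi / 2) ^ m * decay_const (1 + KG * (cmod lam + 1 + KV)) (hdiff_const Cth) m"
    using dist0_power_bound[OF m] unfolding R_def .
qed

end
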